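(* Let $n\ge 1$ be an integer. Consider a game to $n$ of pickleball doubles with conventional side-out scoring, modeled by the Markov chain described in the context. Let $p_A$ (resp., $p_B$) be the probability that Team $A$ (resp., Team $B$) wins a rally when serving, and assume that rallies are independent and $p_A+p_B>0$. Then $$f_n(p_A,p_B):=\mathrm{P}(\text{Team } A \text{ wins game to } n\mid \text{Team } A \text{ serves first})-\mathrm{P}(\text{Team } A \text{ wins game to } n\mid \text{Team } B \text{ serves first})$$ is a symmetric rational function of $(p_A,p_B)$ on $[0,1]\times[0,1]-\{(0,0)\}$. In the special case in which the teams are evenly matched, that is, $p_A=p_B=:x\in(0,1]$, $$f_n(x,x)=2\,\mathrm{P}(\text{first-serving team wins game to } n)-1.$$
   Context: Side-out scoring chain. Put $q_A:=1-p_A$, $q_B:=1-p_B$. The score set is $\Sigma_n=(\{0,1,\ldots,n-1\}\times\{0,1,\ldots,n-1\})\cup\{(n-1,n),(n,n-1)\}$. The state space consists of the $4n^2+8$ states $(i,j,k)$ with $(i,j)\in\Sigma_n$ and $k\in\{1,2,3,4\}$, together with two absorbing states, "Team $A$ wins" and "Team $B$ wins". In state $(i,j,k)$, Team $A$ has $i$ points, Team $B$ has $j$ points, and $k$ says that the server is Team $A$'s first server ($k=1$), Team $A$'s second server ($k=2$), Team $B$'s first server ($k=3$), or Team $B$'s second server ($k=4$). (The scores $(n-1,n-1)$, $(n-1,n)$, $(n,n-1)$ represent "deuce", "advantage Team $B$", "advantage Team $A$".) Effect of a point for Team $A$ at score $(i,j)$: if $i\le n-2$, the score becomes $(i+1,j)$;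 if $i=n-1$ and $j\le n-2$, Team $A$ wins; $(n-1,n-1)$ becomes $(n,n-1)$; $(n-1,n)$ becomes $(n-1,n-1)$; at $(n,n-1)$ Team $A$ wins. Effect of a point for Team $B$ at score $(i,j)$: if $j\le n-2$, the score becomes $(i,j+1)$; if $j=n-1$ and $i\le n-2$, Team $B$ wins; $(n-1,n-1)$ becomes $(n-1,n)$; $(n,n-1)$ becomes $(n-1,n-1)$; at $(n-1,n)$ Team $B$ wins. Transitions (one step is one rally): from $(i,j,k)$ with $k\in\{1,2\}$, with probability $p_A$ Team $A$ gets a point and $k$ is unchanged (unless the game ends), and with probability $q_A$ the score is unchanged and $k$ becomes $k+1$. From $(i,j,k)$ with $k\in\{3,4\}$, with probability $p_B$ Team $B$ gets a point and $k$ is unchanged (unless the game ends), and with probability $q_B$ the score is unchanged and $k$ becomes $4$ if $k=3$, and $1$ if $k=4$. The initial state is $(0,0,2)$ if Team $A$ serves first and $(0,0,4)$ if Team $B$ serves first. "Team $A$ wins game to $n$" is the event that the chain is absorbed at "Team $A$ wins"; similarly for Team $B$. "Symmetric" means $f_n(p_A,p_B)=f_n(p_B,p_A)$. "Rational function on a set" means equal on that set to a quotient of two polynomials in $(p_A,p_B)$ with denominator nonvanishing on that set. When $p_A=p_B$, $\mathrm{P}(\text{first-serving team wins game to } n)$ denotes the common value of $\mathrm{P}(\text{Team } A \text{ wins}\mid \text{Team } A \text{ serves first})$ and $\mathrm{P}(\text{Team } B \text{ wins}\mid \text{Team } B \text{ serves first})$. *)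

theory Defs
  imports "HOL-Probability.Probability" "HOL-Computational_Algebra.Polynomial"
begin

section \<open>Path measure of a time-homogeneous Markov chain\<close>

definition path_kernel :: "('s \<Rightarrow> 's pmf) \<Rightarrow> 's \<Rightarrow> nat \<Rightarrow> (nat \<Rightarrow> 's) \<Rightarrow> 's measure" where
  "path_kernel K s i \<omega> = measure_pmf (if i = 0 then return_pmf s else K (\<omega> (i - 1)))"

lemma Ionescu_Tulcea_path_kernel:
  "Ionescu_Tulcea (path_kernel K s) (\<lambda>_. count_space UNIV)"
proof (rule Ionescu_Tulcea.intro)
  fix i
  show "path_kernel K s i \<in> measurable (PiM {0..<i} (\<lambda>_. count_space UNIV)) (subprob_algebra (count_space UNIV))"
  proof (cases i)
    case 0
    then show ?thesis
      by (simp add: path_kernel_def[abs_def] measure_pmf_in_subprob_algebra)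
  next
    case (Suc m)
    have "(\<lambda>\<omega>. measure_pmf (K (\<omega> m))) \<in>
        measurable (PiM {0..<i} (\<lambda>_. count_space UNIV)) (subprob_algebra (count_space UNIV))"
      by (rule measurable_compose[OF measurable_component_singleton[of m]])
        (auto simp: Suc measure_pmf_in_subprob_algebra)
    with Suc show ?thesis by (simp add: path_kernel_def[abs_def])
  qed
next
  show "prob_space (path_kernel K s i \<omega>)"
    if "\<omega> \<in> space (PiM {0..<i} (\<lambda>_. count_space UNIV))" for i \<omega>
    unfolding path_kernel_def by (rule measure_pmf.prob_space_axioms)
qed

text \<open>The law on trajectories of the chain with transition kernel \<open>K\<close> started at \<open>s\<close>, obtained
  from the Ionescu-Tulcea theorem.\<close>

definition path_measure :: "('s \<Rightarrow> 's pmf) \<Rightarrow> 's \<Rightarrow> (nat \<Rightarrow> 's) measure" where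
  "path_measure K s =
     projective_family.lim UNIV (Ionescu_Tulcea.CI (path_kernel K s) (\<lambda>_. count_space UNIV))
       (\<lambda>_. count_space UNIV)"

lemma sets_path_measure [measurable_cong]:
  "sets (path_measure K s) = sets (PiM UNIV (\<lambda>_. count_space UNIV))"
proof -
  interpret IT: Ionescu_Tulcea "path_kernel K s" "\<lambda>_. count_space UNIV"
    by (rule Ionescu_Tulcea_path_kernel)
  show ?thesis by (simp add: path_measure_def)
qed

lemma space_path_measure [simp]: "space (path_measure K s) = UNIV"
  using sets_eq_imp_space_eq[OF sets_path_measure[of K s]] by (simp add: space_PiM)

lemma emeasure_path_measure_cylinder:
  "emeasure (path_measure K s) {\<omega>. \<forall>i\<le>t. \<omega> i = x i} =
     ennreal (of_bool (x 0 = s) * (\<Prod>i<t. pmf (K (x i)) (x (Suc i))))"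
proof -
  let ?M = "\<lambda>_::nat. count_space (UNIV :: 'a set)"
  interpret IT: Ionescu_Tulcea "path_kernel K s" ?M
    by (rule Ionescu_Tulcea_path_kernel)
  let ?x = "\<lambda>n. restrict x {0..<n}"
  let ?u = "\<lambda>_::nat. undefined :: 'a"
  have sing: "{?x n} \<in> sets (PiM {0..<n} ?M)" for n
  proof -
    have "PiE {0..<n} (\<lambda>i. {x i}) \<in> sets (PiM {0..<n} ?M)"
      by (rule sets_PiM_I_finite) auto
    then show ?thesis by (simp add: PiE_singleton[of "?x n" "{0..<n}", symmetric] cong: PiE_cong)
  qed
  have C: "emeasure (IT.C 0 (Suc n) ?u) {?x (Suc n)} =
     ennreal (of_bool (x 0 = s) * (\<Prod>i<n. pmf (K (x i)) (x (Suc i))))" for n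
  proof -
    have step: "emeasure (IT.C 0 (Suc n) ?u) {?x (Suc n)} =
      emeasure (path_kernel K s n (?x n)) {x n} * emeasure (IT.C 0 n ?u) {?x n}" for n
    proof -
      have spu: "?u \<in> space (PiM {0..<0} ?M)" by (simp add: space_PiM)
      have ne: "space (IT.C 0 n ?u) \<noteq> {}"
        using prob_space.not_empty[OF IT.prob_space_C[OF spu]] .
      have eP: "IT.eP n \<in> measurable (IT.C 0 n ?u) (subprob_algebra (PiM {0..<Suc n} ?M))"
        using IT.measurable_eP[of n] by (simp cong: measurable_cong_sets add: IT.sets_C[OF spu])
      have "emeasure (IT.C 0 (Suc n) ?u) {?x (Suc n)} =
          (\<integral>\<^sup>+\<omega>. emeasure (IT.eP n \<omega>) {?x (Suc n)} \<partial>IT.C 0 n ?u)"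
        by (simp add: emeasure_bind[OF ne eP sing])
      also have "\<dots> = (\<integral>\<^sup>+\<omega>. emeasure (path_kernel K s n (?x n)) {x n} * indicator {?x n} \<omega> \<partial>IT.C 0 n ?u)"
      proof (rule nn_integral_cong)
        fix \<omega> assume "\<omega> \<in> space (IT.C 0 n ?u)"
        then have \<omega>: "\<omega> \<in> space (PiM {0..<n} ?M)"
          using IT.space_C[OF spu, of n] by simp
        then have ext: "\<omega> \<in> extensional {0..<n}" by (simp add: space_PiM PiE_def)
        have "fun_upd \<omega> n y = ?x (Suc n) \<longleftrightarrow> \<omega> = ?x n \<and> y = x n" for y
        proof
          assume *: "fun_upd \<omega> n y = ?x (Suc n)"
          have "\<omega> i = ?x n i" for i
            using fun_cong[OF *, of i] ext by (cases "i < n") (auto simp: extensional_def)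
          moreover have "y = x n" using fun_cong[OF *, of n] by simp
          ultimately show "\<omega> = ?x n \<and> y = x n" by blast
        qed (auto simp: fun_eq_iff)
        then have vim: "(\<lambda>y. fun_upd \<omega> n y) -` {?x (Suc n)} = {y. \<omega> = ?x n \<and> y = x n}"
          by (simp only: vimage_def singleton_iff)
        show "emeasure (IT.eP n \<omega>) {?x (Suc n)} =
            emeasure (path_kernel K s n (?x n)) {x n} * indicator {?x n} \<omega>"
          unfolding IT.emeasure_eP[OF \<omega> sing] vim by (cases "\<omega> = ?x n") simp_all
      qed
      also have "\<dots> = emeasure (path_kernel K s n (?x n)) {x n} * emeasure (IT.C 0 n ?u) {?x n}"
        using sing[of n] IT.sets_C[OF spu, of n] by (subst nn_integral_cmult_indicator) auto
      finally show ?thesis .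
    qed
    have x0: "?x 0 = ?u" by (simp add: fun_eq_iff)
    show ?thesis
    proof (induction n)
      case 0
      have "emeasure (IT.C 0 0 ?u) {?x 0} = 1"
        using sing[of 0] by (simp add: x0[simplified])
      then show ?case
        unfolding step[of 0] by (simp add: path_kernel_def emeasure_pmf_single of_bool_def)
    next
      case (Suc n)
      show ?case
        unfolding step[of "Suc n"] Suc.IH
        by (simp add: path_kernel_def emeasure_pmf_single ennreal_mult'[symmetric] mult_ac)
    qed
  qed
  have eq: "{\<omega>. \<forall>i\<le>t. \<omega> i = x i} = IT.PF.emb UNIV {0..<Suc t} {?x (Suc t)}"
    by (auto simp: prod_emb_iff less_Suc_eq_le restrict_def fun_eq_iff) metis
  show ?thesis
    unfolding path_measure_def eq
    by (subst IT.lim[OF _ sing], simp, subst IT.emeasure_CI[of _ "Suc t", OF _ sing], simp)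
      (use C[of t] sing in \<open>simp del: IT.C.simps add: prod_emb_id sets.sets_into_space\<close>)
qed


section \<open>Side-out scoring\<close>

datatype team = Team_A | Team_B

datatype server = A1 | A2 | B1 | B2

datatype state = Playing nat nat server | Wins team

definition scores :: "nat \<Rightarrow> (nat \<times> nat) set" where
  "scores n = {0..<n} \<times> {0..<n} \<union> {(n - 1, n), (n, n - 1)}"

definition states :: "nat \<Rightarrow> state set" where
  "states n = {Playing i j k | i j k. (i, j) \<in> scores n} \<union> {Wins Team_A, Wins Team_B}"

text \<open>The conditions are written additively because of truncated subtraction at \<open>n = 1\<close>. On
  \<^term>\<open>scores n\<close> the last branch of each function applies only at advantage for the
  team that scores; the values outside \<^term>\<open>scores n\<close> are irrelevant.\<close>

definition point_A :: "nat \<Rightarrow> nat \<Rightarrow> nat \<Rightarrow> server \<Rightarrow> state" where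
  "point_A n i j k =
     (if i + 2 \<le> n then Playing (i + 1) j k
      else if i + 1 = n \<and> j + 2 \<le> n then Wins Team_A
      else if i + 1 = n \<and> j + 1 = n then Playing n (n - 1) k
      else if i + 1 = n \<and> j = n then Playing (n - 1) (n - 1) k
      else Wins Team_A)"

definition point_B :: "nat \<Rightarrow> nat \<Rightarrow> nat \<Rightarrow> server \<Rightarrow> state" where
  "point_B n i j k =
     (if j + 2 \<le> n then Playing i (j + 1) k
      else if j + 1 = n \<and> i + 2 \<le> n then Wins Team_B
      else if i + 1 = n \<and> j + 1 = n then Playing (n - 1) n k
      else if i = n \<and> j + 1 = n then Playing (n - 1) (n - 1) k
      else Wins Team_B)"

fun rally :: "nat \<Rightarrow> real \<Rightarrow> real \<Rightarrow> state \<Rightarrow> state pmf" where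
  "rally n pA pB (Playing i j A1) =
     map_pmf (\<lambda>w. if w then point_A n i j A1 else Playing i j A2) (bernoulli_pmf pA)"
| "rally n pA pB (Playing i j A2) =
     map_pmf (\<lambda>w. if w then point_A n i j A2 else Playing i j B1) (bernoulli_pmf pA)"
| "rally n pA pB (Playing i j B1) =
     map_pmf (\<lambda>w. if w then point_B n i j B1 else Playing i j B2) (bernoulli_pmf pB)"
| "rally n pA pB (Playing i j B2) =
     map_pmf (\<lambda>w. if w then point_B n i j B2 else Playing i j A1) (bernoulli_pmf pB)"
| "rally n pA pB (Wins T) = return_pmf (Wins T)"

fun initial :: "team \<Rightarrow> state" where
  "initial Team_A = Playing 0 0 A2"
| "initial Team_B = Playing 0 0 B2"

lemma initial_in_states: "n \<ge> 1 \<Longrightarrow> initial F \<in> states n"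
  by (cases F) (auto simp: states_def scores_def)

lemma rally_in_states:
  assumes "n \<ge> 1" "s \<in> states n"
  shows "set_pmf (rally n pA pB s) \<subseteq> states n"
proof (cases s)
  case (Playing i j k)
  with assms have ij: "(i, j) \<in> scores n" by (auto simp: states_def)
  have "point_A n i j k \<in> states n" "point_B n i j k \<in> states n"
    using ij \<open>n \<ge> 1\<close> by (auto simp: point_A_def point_B_def states_def scores_def)
  moreover have "Playing i j k' \<in> states n" for k'
    using ij by (auto simp: states_def)
  ultimately show ?thesis
    unfolding Playing by (cases k) auto
qed (use assms in auto)

text \<open>\<open>win_prob n pA pB W F\<close> is the probability that team \<open>W\<close> wins the game to \<open>n\<close>
  when team \<open>F\<close> serves first.\<close>

definition win_prob :: "nat \<Rightarrow> real \<Rightarrow> real \<Rightarrow> team \<Rightarrow> team \<Rightarrow> real" where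
  "win_prob n pA pB W F =
     measure (path_measure (rally n pA pB) (initial F)) {\<omega>. \<exists>t. \<omega> t = Wins W}"

definition serve_gain :: "nat \<Rightarrow> real \<Rightarrow> real \<Rightarrow> real" where
  "serve_gain n pA pB = win_prob n pA pB Team_A Team_A - win_prob n pA pB Team_A Team_B"


section \<open>Functions of two real variables\<close>

text \<open>A polynomial in \<open>(x, y)\<close> is a polynomial in \<open>x\<close> whose coefficients are polynomials in \<open>y\<close>.\<close>

definition poly2 :: "real poly poly \<Rightarrow> real \<Rightarrow> real \<Rightarrow> real" where
  "poly2 P x y = poly (poly P [:x:]) y"

definition rational_function_on :: "(real \<times> real) set \<Rightarrow> (real \<Rightarrow> real \<Rightarrow> real) \<Rightarrow> bool" where
  "rational_function_on D f \<longleftrightarrow>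
     (\<exists>P Q. \<forall>(x, y) \<in> D. poly2 Q x y \<noteq> 0 \<and> f x y = poly2 P x y / poly2 Q x y)"

definition symmetric_on :: "(real \<times> real) set \<Rightarrow> (real \<Rightarrow> real \<Rightarrow> real) \<Rightarrow> bool" where
  "symmetric_on D f \<longleftrightarrow> (\<forall>(x, y) \<in> D. f x y = f y x)"

end

theory Submission
  imports Defs "Jordan_Normal_Form.Determinant"
begin

text \<open>From every state of the chain an absorbing state is reachable as soon as one of \<open>p\<^sub>A\<close>,
  \<open>p\<^sub>B\<close> is positive, so by the maximum principle a function on the finite state space that is
  harmonic for the chain is determined by its values at the two absorbing states. Three consequences:
  the winning probabilities of the teams add up to 1; exchanging the roles of the teams exchanges
  \<open>p\<^sub>A\<close> and \<open>p\<^sub>B\<close>; and the linear system of first-step analysis has nonzero determinant on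
  the whole parameter set, so by Cramer's rule its solution is rational there. With \<open>g(p\<^sub>A, p\<^sub>B)\<close>
  the probability that Team A wins when serving first, the first two give
  \<open>f(p\<^sub>A, p\<^sub>B) = g(p\<^sub>A, p\<^sub>B) + g(p\<^sub>B, p\<^sub>A) - 1\<close>.\<close>

section \<open>Hitting probabilities\<close>

definition hit_prob :: "('s \<Rightarrow> 's pmf) \<Rightarrow> 's \<Rightarrow> 's \<Rightarrow> real" where
  "hit_prob K w s = measure (path_measure K s) {\<omega>. \<exists>t. \<omega> t = w}"

text \<open>Law of the first \<open>Suc t\<close> states, start included. The recursion splits off
  the first transition, so that first-step analysis can be read off the defining equations.\<close>

fun path_pmf :: "('s \<Rightarrow> 's pmf) \<Rightarrow> nat \<Rightarrow> 's \<Rightarrow> 's list pmf" where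
  "path_pmf K 0 s = return_pmf [s]"
| "path_pmf K (Suc t) s = bind_pmf (K s) (\<lambda>u. map_pmf ((#) s) (path_pmf K t u))"

lemma length_path_pmf: "xs \<in> set_pmf (path_pmf K t s) \<Longrightarrow> length xs = Suc t"
  by (induction t arbitrary: s xs) auto

text \<open>The right-hand side has the form of \<open>emeasure_path_measure_cylinder\<close>, so
  the path measure and the finite laws can be compared list by list.\<close>

lemma pmf_path_pmf:
  "pmf (path_pmf K t s) (map x [0..<Suc t]) =
     of_bool (x 0 = s) * (\<Prod>i<t. pmf (K (x i)) (x (Suc i)))"
proof (induction t arbitrary: s x)
  case 0
  then show ?case by (auto simp: pmf_return)
next
  case (Suc t)
  have split: "map x [0..<Suc (Suc t)] = x 0 # map (\<lambda>i. x (Suc i)) [0..<Suc t]"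
    by (rule nth_equalityI) (auto simp: nth_Cons nth_append less_Suc_eq split: nat.splits)
  have "pmf (map_pmf ((#) s) (path_pmf K t u)) (map x [0..<Suc (Suc t)]) =
      indicator {x 1} u * (of_bool (x 0 = s) * (\<Prod>i<t. pmf (K (x (Suc i))) (x (Suc (Suc i)))))" for u
  proof (cases "x 0 = s")
    case True
    then show ?thesis
      unfolding split using pmf_map_inj'[of "(#) s" "path_pmf K t u"] Suc.IH[of u "\<lambda>i. x (Suc i)"]
      by (simp del: upt_Suc add: indicator_def)
  next
    case False
    then show ?thesis
      unfolding split by (simp del: upt_Suc) (auto intro!: pmf_map_outside simp del: upt_Suc)
  qed
  then show ?case
    by (simp del: upt_Suc prod.lessThan_Suc
        add: pmf_bind prod.lessThan_Suc_shift measure_pmf_single)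
qed

lemma measurable_path_prefix:
  "(\<lambda>\<omega>. map \<omega> [0..<t]) \<in> measurable (path_measure K s) (count_space (UNIV :: 's :: countable list set))"
proof (induction t)
  case (Suc t)
  have [measurable]: "(\<lambda>\<omega>. \<omega> t) \<in> measurable (path_measure K s) (count_space UNIV)"
    by measurable
  note [measurable] = Suc
  have "(\<lambda>\<omega>. map \<omega> [0..<t] @ [\<omega> t]) \<in> measurable (path_measure K s) (count_space UNIV)"
    by measurable
  then show ?case by simp
qed simp

text \<open>On a countable space point masses decide: a list of length \<open>Suc t\<close>
  corresponds to a cylinder, and any other list has mass zero on both sides.\<close>

lemma distr_path_prefix:
  fixes K :: "'s :: countable \<Rightarrow> 's pmf"
  shows "distr (path_measure K s) (count_space UNIV) (\<lambda>\<omega>. map \<omega> [0..<Suc t]) = path_pmf K t s"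
proof (rule measure_eqI_countable[where A = UNIV])
  fix xs :: "'s list"
  have "emeasure (distr (path_measure K s) (count_space UNIV) (\<lambda>\<omega>. map \<omega> [0..<Suc t])) {xs} =
      emeasure (path_measure K s) {\<omega>. map \<omega> [0..<Suc t] = xs}"
    by (subst emeasure_distr[OF measurable_path_prefix]) (auto simp: vimage_def)
  also have "\<dots> = ennreal (pmf (path_pmf K t s) xs)"
  proof (cases "length xs = Suc t")
    case True
    then have xs: "map ((!) xs) [0..<Suc t] = xs"
      by (metis map_nth)
    have "(map \<omega> [0..<Suc t] = xs) = (\<forall>i\<le>t. \<omega> i = xs ! i)" for \<omega>
      using True by (auto simp del: upt_Suc simp: list_eq_iff_nth_eq less_Suc_eq_le)
    then show ?thesis
      using emeasure_path_measure_cylinder[of K s t "(!) xs"] pmf_path_pmf[of K t s "(!) xs"]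
      unfolding xs by simp
  next
    case False
    then have "{\<omega>. map \<omega> [0..<Suc t] = xs} = {}" by auto
    moreover have "pmf (path_pmf K t s) xs = 0"
      using False length_path_pmf[of xs K t s] by (auto simp: pmf_eq_0_set_pmf)
    ultimately show ?thesis by simp
  qed
  finally show "emeasure (distr (path_measure K s) (count_space UNIV) (\<lambda>\<omega>. map \<omega> [0..<Suc t])) {xs} =
      emeasure (path_pmf K t s) {xs}"
    by (simp add: emeasure_pmf_single)
qed auto

text \<open>The event of visiting \<open>w\<close> among the first \<open>Suc t\<close> states
  increases with \<open>t\<close> to the hitting event, so continuity from below applies. This
  reduces questions about hitting probabilities to finite laws.\<close>

lemma hit_prob_LIMSEQ:
  fixes K :: "'s :: countable \<Rightarrow> 's pmf"
  shows "(\<lambda>t. measure_pmf.prob (path_pmf K t s) {xs. w \<in> set xs}) \<longlonglongrightarrow> hit_prob K w s"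
proof -
  define A where "A t = {\<omega>. w \<in> set (map \<omega> [0..<Suc t])}" for t
  have meas: "A t \<in> sets (path_measure K s)" for t
    using measurable_sets[OF measurable_path_prefix, of "{xs. w \<in> set xs}" "Suc t" K s]
    by (simp add: A_def vimage_def del: upt_Suc)
  have prefix: "measure (path_measure K s) (A t) = measure_pmf.prob (path_pmf K t s) {xs. w \<in> set xs}"
    for t
    unfolding distr_path_prefix[symmetric]
    by (subst measure_distr[OF measurable_path_prefix])
      (auto simp: A_def vimage_def simp del: upt_Suc)
  have "emeasure (path_measure K s) UNIV = 1"
  proof -
    have "emeasure (distr (path_measure K s) (count_space UNIV) (\<lambda>\<omega>. map \<omega> [0..<Suc 0])) UNIV = 1"
      unfolding distr_path_prefix by (simp add: measure_pmf.emeasure_space_1[simplified])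
    then show ?thesis
      by (subst (asm) emeasure_distr[OF measurable_path_prefix]) auto
  qed
  then interpret prob_space "path_measure K s"
    by (intro prob_spaceI) simp
  have "(\<lambda>t. measure (path_measure K s) (A t)) \<longlonglongrightarrow> measure (path_measure K s) (\<Union>t. A t)"
    by (rule finite_Lim_measure_incseq) (use meas in \<open>force simp: A_def incseq_def simp del: upt_Suc\<close>)+
  also have "(\<Union>t. A t) = {\<omega>. \<exists>t. \<omega> t = w}"
    by (auto simp: A_def image_iff simp del: upt_Suc)
      (metis atLeastLessThan_iff lessI zero_le)
  finally show ?thesis by (simp add: hit_prob_def prefix)
qed

lemma hit_prob_self:
  fixes K :: "'s :: countable \<Rightarrow> 's pmf"
  shows "hit_prob K w w = 1"
proof -
  have "measure_pmf.prob (path_pmf K t w) {xs. w \<in> set xs} = 1" for t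
    by (cases t) (auto simp: measure_pmf.prob_eq_1 AE_measure_pmf_iff)
  with hit_prob_LIMSEQ[of K w w] show ?thesis
    by (simp add: LIMSEQ_const_iff)
qed

text \<open>As \<open>s \<noteq> w\<close>, the start is no visit to \<open>w\<close>, so the
  finite-time probabilities satisfy the one-step recursion; they are bounded by 1, and dominated
  convergence gives the limit.\<close>

lemma hit_prob_first_step:
  fixes K :: "'s :: countable \<Rightarrow> 's pmf"
  assumes "s \<noteq> w"
  shows "hit_prob K w s = measure_pmf.expectation (K s) (hit_prob K w)"
proof -
  let ?q = "\<lambda>t s. measure_pmf.prob (path_pmf K t s) {xs. w \<in> set xs}"
  have step: "?q (Suc t) s = measure_pmf.expectation (K s) (?q t)" for t
  proof -
    have "?q (Suc t) s =
        measure_pmf.expectation (K s) (\<lambda>u. measure_pmf.prob (map_pmf ((#) s) (path_pmf K t u)) {xs. w \<in> set xs})"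
      unfolding path_pmf.simps measure_pmf_bind
      by (rule measure_pmf.measure_bind[where N = "count_space UNIV"])
        (auto simp: measure_pmf_in_subprob_algebra)
    also have "\<dots> = measure_pmf.expectation (K s) (?q t)"
      using assms by (simp add: vimage_def)
    finally show ?thesis .
  qed
  have "(\<lambda>t. measure_pmf.expectation (K s) (?q t)) \<longlonglongrightarrow> measure_pmf.expectation (K s) (hit_prob K w)"
    by (rule integral_dominated_convergence[where w = "\<lambda>_. 1"])
      (auto intro: hit_prob_LIMSEQ)
  moreover have "(\<lambda>t. ?q (Suc t) s) \<longlonglongrightarrow> hit_prob K w s"
    using hit_prob_LIMSEQ by (rule LIMSEQ_Suc)
  ultimately show ?thesis
    unfolding step by (metis LIMSEQ_unique)
qed

lemma hit_prob_absorbing: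
  fixes K :: "'s :: countable \<Rightarrow> 's pmf"
  assumes "K s = return_pmf s" "s \<noteq> w"
  shows "hit_prob K w s = 0"
proof -
  have "measure_pmf.prob (path_pmf K t s) {xs. w \<in> set xs} = 0" for t
    using assms by (induction t) (simp_all add: bind_return_pmf vimage_def)
  with hit_prob_LIMSEQ[of K s w] show ?thesis
    by (simp add: LIMSEQ_const_iff)
qed

section \<open>Uniqueness of harmonic functions\<close>

text \<open>Maximum principle: the set where \<open>v\<close> attains its maximum over
  \<open>S\<close> is closed under transitions, so by \<open>trap\<close> it meets \<open>B\<close>,
  where \<open>v\<close> vanishes.\<close>

lemma harmonic_nonpos:
  fixes K :: "'s \<Rightarrow> 's pmf" and v :: "'s \<Rightarrow> real"
  assumes "finite S"
    and closed: "\<And>s. s \<in> S \<Longrightarrow> set_pmf (K s) \<subseteq> S"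
    and harmonic: "\<And>s. s \<in> S \<Longrightarrow> v s = measure_pmf.expectation (K s) v"
    and boundary: "\<And>s. s \<in> B \<Longrightarrow> v s = 0"
    and trap: "\<And>C. C \<subseteq> S \<Longrightarrow> C \<noteq> {} \<Longrightarrow> (\<forall>s\<in>C. set_pmf (K s) \<subseteq> C) \<Longrightarrow> C \<inter> B \<noteq> {}"
    and "s \<in> S"
  shows "v s \<le> 0"
proof -
  define m where "m = Max (v ` S)"
  have le: "v u \<le> m" if "u \<in> S" for u
    using that \<open>finite S\<close> by (simp add: m_def)
  define C where "C = {u \<in> S. v u = m}"
  have "m \<in> v ` S"
    unfolding m_def using \<open>finite S\<close> \<open>s \<in> S\<close> by (intro Max_in) auto
  then have "C \<noteq> {}" by (auto simp: C_def)
  moreover have "set_pmf (K u) \<subseteq> C" if "u \<in> C" for u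
  proof -
    have u: "u \<in> S" "v u = m" using that by (auto simp: C_def)
    have fin: "finite (set_pmf (K u))"
      using closed[OF u(1)] \<open>finite S\<close> by (rule finite_subset)
    \<comment> \<open>By harmonicity the gap \<open>m - v\<close> has mean zero; being nonnegative
      on the successors of \<open>u\<close>, it vanishes on all of them.\<close>
    have "measure_pmf.expectation (K u) (\<lambda>a. m - v a) = 0"
      using harmonic[OF u(1)] u(2) fin
      by (simp add: Bochner_Integration.integral_diff integrable_measure_pmf_finite)
    moreover have "AE a in K u. 0 \<le> m - v a"
      using closed[OF u(1)] le by (auto simp: AE_measure_pmf_iff)
    ultimately have "AE a in K u. m - v a = 0"
      using fin by (subst (asm) integral_nonneg_eq_0_iff_AE) (auto intro: integrable_measure_pmf_finite)
    then show ?thesis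
      using closed[OF u(1)] by (auto simp: AE_measure_pmf_iff C_def)
  qed
  ultimately have "C \<inter> B \<noteq> {}"
    by (intro trap) (auto simp: C_def)
  then have "m = 0" using boundary by (auto simp: C_def)
  with le \<open>s \<in> S\<close> show ?thesis by auto
qed

lemma harmonic_eq_0:
  fixes K :: "'s \<Rightarrow> 's pmf" and v :: "'s \<Rightarrow> real"
  assumes "finite S"
    and "\<And>s. s \<in> S \<Longrightarrow> set_pmf (K s) \<subseteq> S"
    and "\<And>s. s \<in> S \<Longrightarrow> v s = measure_pmf.expectation (K s) v"
    and "\<And>s. s \<in> B \<Longrightarrow> v s = 0"
    and "\<And>C. C \<subseteq> S \<Longrightarrow> C \<noteq> {} \<Longrightarrow> (\<forall>s\<in>C. set_pmf (K s) \<subseteq> C) \<Longrightarrow> C \<inter> B \<noteq> {}"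
    and "s \<in> S"
  shows "v s = 0"
proof (rule antisym)
  show "v s \<le> 0"
    using assms by (rule harmonic_nonpos)
  have "- v s \<le> 0"
    by (rule harmonic_nonpos[where v = "\<lambda>s. - v s" and S = S and K = K and B = B])
      (use assms in auto)
  then show "0 \<le> v s" by simp
qed

section \<open>Parametrised linear systems\<close>

text \<open>Makes evaluation at a point commute with determinants.\<close>

lemma comm_ring_hom_poly2: "comm_ring_hom (\<lambda>P. poly2 P x y)"
  by unfold_locales (auto simp: poly2_def)

text \<open>Cramer's rule: \<open>P\<close> and \<open>Q\<close> are determinants taken over the
  polynomial ring, before evaluation, so one pair serves all points. At each point of
  \<open>D\<close>, \<open>unique\<close> leaves the evaluated matrix no nonzero kernel vector,
  hence \<open>Q\<close> does not vanish there.\<close>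

lemma rational_function_on_linear_system:
  fixes M :: "'s \<Rightarrow> 's \<Rightarrow> real poly poly" and c :: "'s \<Rightarrow> real poly poly"
    and h :: "real \<Rightarrow> real \<Rightarrow> 's \<Rightarrow> real"
  assumes "finite S"
    and solution: "\<And>x y s. (x, y) \<in> D \<Longrightarrow> s \<in> S \<Longrightarrow>
      h x y s = (\<Sum>t\<in>S. poly2 (M s t) x y * h x y t) + poly2 (c s) x y"
    and unique: "\<And>x y s v. (x, y) \<in> D \<Longrightarrow> (\<And>s. s \<in> S \<Longrightarrow> v s = (\<Sum>t\<in>S. poly2 (M s t) x y * v t)) \<Longrightarrow>
      s \<in> S \<Longrightarrow> v s = 0"
    and "s \<in> S"
  shows "rational_function_on D (\<lambda>x y. h x y s)"
proof -
  define N where "N = card S"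
  obtain e where e: "bij_betw e {0..<N} S"
    using ex_bij_betw_nat_finite[OF \<open>finite S\<close>] N_def by blast
  have eS: "e i \<in> S" if "i < N" for i
    using e that by (auto simp: bij_betw_def)
  have reindex: "(\<Sum>t\<in>S. g t) = (\<Sum>j = 0..<N. g (e j))" for g :: "'s \<Rightarrow> real"
    using sum.reindex_bij_betw[OF e] by metis
  obtain k where k: "k < N" "e k = s"
    using e \<open>s \<in> S\<close> by (force simp: bij_betw_def)
  define A where "A = Matrix.mat N N (\<lambda>(i, j). of_bool (i = j) - M (e i) (e j))"
  define b where "b = Matrix.vec N (\<lambda>i. c (e i))"
  have A: "A \<in> carrier_mat N N" by (simp add: A_def)
  define Q where "Q = Determinant.det A"
  define P where "P = Determinant.det (replace_col A b k)"
  have "poly2 Q x y \<noteq> 0 \<and> h x y s = poly2 P x y / poly2 Q x y" if D: "(x, y) \<in> D" for x y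
  proof -
    interpret hom: comm_ring_hom "\<lambda>P. poly2 P x y"
      by (rule comm_ring_hom_poly2)
    define A' where "A' = map_mat (\<lambda>P. poly2 P x y) A"
    have A': "A' \<in> carrier_mat N N" using A by (simp add: A'_def)
    \<comment> \<open>The evaluated matrix acts as the identity minus \<open>M\<close>, so its
      kernel vectors solve the homogeneous system in \<open>unique\<close>.\<close>
    have mult: "vec_index (A' *\<^sub>v v) i =
        vec_index v i - (\<Sum>j = 0..<N. poly2 (M (e i) (e j)) x y * vec_index v j)"
      if "i < N" "v \<in> carrier_vec N" for i v
    proof -
      have "vec_index (A' *\<^sub>v v) i =
          (\<Sum>j = 0..<N. (of_bool (i = j) - poly2 (M (e i) (e j)) x y) * vec_index v j)"
        using that by (auto simp: A'_def A_def scalar_prod_def hom.hom_minus intro!: sum.cong)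
      also have "\<dots> = (\<Sum>j = 0..<N. of_bool (i = j) * vec_index v j) -
          (\<Sum>j = 0..<N. poly2 (M (e i) (e j)) x y * vec_index v j)"
        by (simp add: left_diff_distrib sum_subtractf)
      also have "(\<Sum>j = 0..<N. of_bool (i = j) * vec_index v j) = vec_index v i"
        using that by (simp add: of_bool_def if_distrib[of "\<lambda>z. z * _"] cong: if_cong)
      finally show ?thesis .
    qed
    have det: "poly2 Q x y = Determinant.det A'"
      unfolding Q_def A'_def by simp
    have "Determinant.det A' \<noteq> 0"
    proof
      assume "Determinant.det A' = 0"
      then obtain v where v: "v \<in> carrier_vec N" "v \<noteq> 0\<^sub>v N" "A' *\<^sub>v v = 0\<^sub>v N"
        using det_0_iff_vec_prod_zero_field[OF A'] by blast
      define w where "w t = vec_index v (the_inv_into {0..<N} e t)" for t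
      have we: "w (e i) = vec_index v i" if "i < N" for i
        using e that by (simp add: w_def bij_betw_def the_inv_into_f_f)
      have w0: "w t = 0" if "t \<in> S" for t
      proof (rule unique[OF D _ that])
        fix u assume "u \<in> S"
        then obtain i where i: "i < N" "e i = u"
          using e by (force simp: bij_betw_def)
        have "vec_index v i = (\<Sum>j = 0..<N. poly2 (M (e i) (e j)) x y * vec_index v j)"
          using mult[OF i(1) v(1)] i(1) v(3) by simp
        then show "w u = (\<Sum>t\<in>S. poly2 (M u t) x y * w t)"
          unfolding reindex using i by (auto simp: we intro!: sum.cong)
      qed
      have "v = 0\<^sub>v N"
      proof (rule eq_vecI)
        show "vec_index v i = vec_index (0\<^sub>v N) i" if "i < dim_vec (0\<^sub>v N)" for i
          using that w0[OF eS[of i]] we[of i] by simp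
      qed (use v(1) in simp)
      with v(2) show False by simp
    qed
    moreover have "h x y s * Determinant.det A' = poly2 P x y"
    proof -
      define z where "z = Matrix.vec N (\<lambda>i. h x y (e i))"
      have z: "z \<in> carrier_vec N" by (simp add: z_def)
      have "A' *\<^sub>v z = map_vec (\<lambda>P. poly2 P x y) b"
      proof (rule eq_vecI)
        fix i assume "i < dim_vec (map_vec (\<lambda>P. poly2 P x y) b)"
        then have i: "i < N" by (simp add: b_def)
        have "(\<Sum>j = 0..<N. poly2 (M (e i) (e j)) x y * vec_index z j) =
            (\<Sum>t\<in>S. poly2 (M (e i) t) x y * h x y t)"
          unfolding reindex by (auto simp: z_def)
        then show "vec_index (A' *\<^sub>v z) i = vec_index (map_vec (\<lambda>P. poly2 P x y) b) i"
          using mult[OF i z] solution[OF D eS[OF i]] i by (simp add: z_def b_def)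
      qed (use A' in \<open>simp add: b_def\<close>)
      \<comment> \<open>\<open>A'\<close> sends the solution \<open>z\<close> to the evaluated
        right-hand side, and replacing a column commutes with evaluation.\<close>
      then have "replace_col A' (A' *\<^sub>v z) k = map_mat (\<lambda>P. poly2 P x y) (replace_col A b k)"
        using A A' by (intro eq_matI) (auto simp: replace_col_def A'_def b_def)
      then have "poly2 P x y = Determinant.det (replace_col A' (A' *\<^sub>v z) k)"
        by (simp add: P_def)
      also have "\<dots> = vec_index z k * Determinant.det A'"
        using A' z k(1) by (rule cramer_lemma_mat)
      finally show ?thesis using k by (simp add: z_def)
    qed
    ultimately show ?thesis
      by (simp add: det field_simps)
  qed
  then show ?thesis
    unfolding rational_function_on_def by blast
qed

lemma rational_function_on_diff:
  assumes "rational_function_on D f" "rational_function_on D g"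
  shows "rational_function_on D (\<lambda>x y. f x y - g x y)"
proof -
  obtain P Q where PQ: "\<And>x y. (x, y) \<in> D \<Longrightarrow> poly2 Q x y \<noteq> 0 \<and> f x y = poly2 P x y / poly2 Q x y"
    using assms(1) unfolding rational_function_on_def by blast
  obtain R T where RT: "\<And>x y. (x, y) \<in> D \<Longrightarrow> poly2 T x y \<noteq> 0 \<and> g x y = poly2 R x y / poly2 T x y"
    using assms(2) unfolding rational_function_on_def by blast
  have "poly2 (Q * T) x y \<noteq> 0 \<and> f x y - g x y = poly2 (P * T - R * Q) x y / poly2 (Q * T) x y"
    if "(x, y) \<in> D" for x y
    using PQ[OF that] RT[OF that] by (simp add: poly2_def diff_frac_eq)
  then show ?thesis
    unfolding rational_function_on_def by blast
qed

section \<open>The side-out chain\<close>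

instance team :: countable by countable_datatype
instance server :: countable by countable_datatype
instance state :: countable by countable_datatype

abbreviation parameters :: "(real \<times> real) set" where
  "parameters \<equiv> {0..1} \<times> {0..1} - {(0, 0)}"

lemma finite_states: "finite (states n)"
proof -
  have "finite (scores n)" by (simp add: scores_def)
  moreover have "finite (UNIV :: server set)"
  proof -
    have "UNIV = {A1, A2, B1, B2}" using server.exhaust by auto
    then show ?thesis by (metis finite.emptyI finite.insertI)
  qed
  moreover have "states n \<subseteq>
      (\<lambda>((i, j), k). Playing i j k) ` (scores n \<times> UNIV) \<union> {Wins Team_A, Wins Team_B}"
    by (auto simp: states_def image_iff) force
  ultimately show ?thesis
    by (meson finite_SigmaI finite_UnI finite_imageI finite.intros finite_subset)
qed

section \<open>Reaching an absorbing state\<close>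

lemma set_pmf_bernoulli_True: "0 < p \<Longrightarrow> p \<le> 1 \<Longrightarrow> True \<in> set_pmf (bernoulli_pmf p)"
  by (simp add: set_pmf_iff)

lemma set_pmf_bernoulli_False: "0 \<le> p \<Longrightarrow> p < 1 \<Longrightarrow> False \<in> set_pmf (bernoulli_pmf p)"
  by (simp add: set_pmf_iff)

text \<open>Team A wins a rally on its own serve with positive probability and then keeps the same
  server, so a closed set contains a whole run of points for A, up to victory.\<close>

lemma Wins_A_in_closed_set:
  assumes "C \<subseteq> states n" and closed: "\<forall>s\<in>C. set_pmf (rally n pA pB s) \<subseteq> C"
    and pA: "0 < pA" "pA \<le> 1"
    and "k \<in> {A1, A2}" "Playing i j k \<in> C"
  shows "Wins Team_A \<in> C"
  using assms(6)
  \<comment> \<open>The second summand makes the measure decrease from \<open>(n - 1, n)\<close> to deuce, where \<open>i\<close> does not change.\<close>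
proof (induction "n + 1 - i + (if j = n then 2 else 0)" arbitrary: i j rule: less_induct)
  case less
  have ij: "(i, j) \<in> scores n" using less.prems assms(1) by (auto simp: states_def)
  have "point_A n i j k \<in> set_pmf (rally n pA pB (Playing i j k))"
    using assms(5) set_pmf_bernoulli_True[OF pA] by (auto intro!: image_eqI[where x = True])
  then have "point_A n i j k \<in> C" using closed less.prems by blast
  moreover have "point_A n i j k = Wins Team_A \<or> (\<exists>i' j'. point_A n i j k = Playing i' j' k \<and>
      n + 1 - i' + (if j' = n then 2 else 0) < n + 1 - i + (if j = n then 2 else 0))"
    using ij by (auto simp: point_A_def scores_def)
  ultimately show ?case using less.hyps by (elim disjE exE conjE) (simp, metis)
qed

text \<open>Mirror image for Team B: the extra 2 in the measure now covers the step from
  \<open>(n, n - 1)\<close> to deuce, where \<open>j\<close> does not change.\<close>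

lemma Wins_B_in_closed_set:
  assumes "C \<subseteq> states n" and closed: "\<forall>s\<in>C. set_pmf (rally n pA pB s) \<subseteq> C"
    and pB: "0 < pB" "pB \<le> 1"
    and "k \<in> {B1, B2}" "Playing i j k \<in> C"
  shows "Wins Team_B \<in> C"
  using assms(6)
proof (induction "n + 1 - j + (if i = n then 2 else 0)" arbitrary: i j rule: less_induct)
  case less
  have ij: "(i, j) \<in> scores n" using less.prems assms(1) by (auto simp: states_def)
  have "point_B n i j k \<in> set_pmf (rally n pA pB (Playing i j k))"
    using assms(5) set_pmf_bernoulli_True[OF pB] by (auto intro!: image_eqI[where x = True])
  then have "point_B n i j k \<in> C" using closed less.prems by blast
  moreover have "point_B n i j k = Wins Team_B \<or> (\<exists>i' j'. point_B n i j k = Playing i' j' k \<and>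
      n + 1 - j' + (if i' = n then 2 else 0) < n + 1 - j + (if i = n then 2 else 0))"
    using ij by (auto simp: point_B_def scores_def)
  ultimately show ?case using less.hyps by (elim disjE exE conjE) (simp, metis)
qed

text \<open>A serving team with positive rally probability can win outright. Otherwise it surely
  loses the serve, and the rotation reaches the other team, whose probability is positive because
  \<open>(0, 0)\<close> is excluded.\<close>

lemma Wins_in_closed_set:
  assumes "(pA, pB) \<in> parameters"
    and "C \<subseteq> states n" "C \<noteq> {}" and closed: "\<forall>s\<in>C. set_pmf (rally n pA pB s) \<subseteq> C"
  shows "C \<inter> range Wins \<noteq> {}"
proof -
  have p: "0 \<le> pA" "pA \<le> 1" "0 \<le> pB" "pB \<le> 1" "0 < pA \<or> 0 < pB"
    using assms(1) by auto
  obtain s where "s \<in> C" using \<open>C \<noteq> {}\<close> by blast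
  show ?thesis
  proof (cases s)
    case (Playing i j k)
    have k: "Playing i j k \<in> C" using \<open>s \<in> C\<close> Playing by simp
    have A12: "Playing i j A2 \<in> C" if "Playing i j A1 \<in> C" "pA = 0"
      using closed[THEN bspec, OF that(1)] set_pmf_bernoulli_False[of pA] that(2) by auto
    have A2B: "Playing i j B1 \<in> C" if "Playing i j A2 \<in> C" "pA = 0"
      using closed[THEN bspec, OF that(1)] set_pmf_bernoulli_False[of pA] that(2) by auto
    have B12: "Playing i j B2 \<in> C" if "Playing i j B1 \<in> C" "pB = 0"
      using closed[THEN bspec, OF that(1)] set_pmf_bernoulli_False[of pB] that(2) by auto
    have B2A: "Playing i j A1 \<in> C" if "Playing i j B2 \<in> C" "pB = 0"
      using closed[THEN bspec, OF that(1)] set_pmf_bernoulli_False[of pB] that(2) by auto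
    have A: "Wins Team_A \<in> C" if "0 < pA" "k \<in> {A1, A2}" "Playing i j k \<in> C" for k
      using Wins_A_in_closed_set[OF assms(2) closed that(1) p(2) that(2,3)] .
    have B: "Wins Team_B \<in> C" if "0 < pB" "k \<in> {B1, B2}" "Playing i j k \<in> C" for k
      using Wins_B_in_closed_set[OF assms(2) closed that(1) p(4) that(2,3)] .
    have "Wins Team_A \<in> C \<or> Wins Team_B \<in> C"
    proof (cases "0 < pA")
      case True
      then show ?thesis
      proof (cases "0 < pB \<or> k \<in> {A1, A2}")
        case True
        then show ?thesis
          using A[OF \<open>0 < pA\<close>, of k] B[of k] k by (cases k) simp_all
      next
        case False
        then have "pB = 0" "k = B1 \<or> k = B2" using p by (auto intro: server.exhaust[of k])
        then have "Playing i j A1 \<in> C" using B12 B2A k by blast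
        then show ?thesis using A[OF \<open>0 < pA\<close>, of A1] by simp
      qed
    next
      case False
      then have "pA = 0" "0 < pB" using p by simp_all
      then have "\<exists>k' \<in> {B1, B2}. Playing i j k' \<in> C"
        using A12 A2B k by (cases k) blast+
      then show ?thesis using B[OF \<open>0 < pB\<close>] by blast
    qed
    then show ?thesis by auto
  qed (use \<open>s \<in> C\<close> in auto)
qed

text \<open>Harmonicity is trivial at absorbing states, so it is only asked for elsewhere.\<close>

lemma rally_harmonic_eq_0:
  assumes "n \<ge> 1" "(pA, pB) \<in> parameters"
    and "\<And>s. s \<in> states n \<Longrightarrow> s \<notin> range Wins \<Longrightarrow> v s = measure_pmf.expectation (rally n pA pB s) v"
    and "\<And>T. v (Wins T) = (0 :: real)"
    and "s \<in> states n"
  shows "v s = 0"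
proof (rule harmonic_eq_0[where S = "states n" and K = "rally n pA pB" and B = "range Wins"])
  show "v s = measure_pmf.expectation (rally n pA pB s) v" if "s \<in> states n" for s
    using that assms(3) by (cases "s \<in> range Wins") auto
qed (use assms rally_in_states finite_states Wins_in_closed_set in auto)

section \<open>Winning probabilities from an arbitrary state\<close>

definition win_from :: "nat \<Rightarrow> team \<Rightarrow> real \<Rightarrow> real \<Rightarrow> state \<Rightarrow> real" where
  "win_from n W pA pB = hit_prob (rally n pA pB) (Wins W)"

lemma win_prob_eq: "win_prob n pA pB W F = win_from n W pA pB (initial F)"
  by (simp add: win_prob_def win_from_def hit_prob_def)

lemma win_from_Wins: "win_from n W pA pB (Wins T) = of_bool (T = W)"
  by (auto simp: win_from_def hit_prob_self intro!: hit_prob_absorbing)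

lemma win_from_first_step:
  "s \<notin> range Wins \<Longrightarrow>
    win_from n W pA pB s = measure_pmf.expectation (rally n pA pB s) (win_from n W pA pB)"
  unfolding win_from_def by (rule hit_prob_first_step) auto

lemma finite_set_pmf_rally: "finite (set_pmf (rally n pA pB s))"
  by (cases "(n, pA, pB, s)" rule: rally.cases) auto

text \<open>The sum minus 1 is harmonic and vanishes at both absorbing states; almost sure
  termination thus needs no separate argument.\<close>

lemma win_from_complement:
  assumes "n \<ge> 1" "(pA, pB) \<in> parameters" "s \<in> states n"
  shows "win_from n Team_A pA pB s + win_from n Team_B pA pB s = 1"
proof -
  let ?v = "\<lambda>s. win_from n Team_A pA pB s + win_from n Team_B pA pB s - 1"
  have "?v s = 0"
  proof (rule rally_harmonic_eq_0[OF assms(1,2) _ _ assms(3)])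
    fix s assume "s \<notin> range Wins"
    then show "?v s = measure_pmf.expectation (rally n pA pB s) ?v"
      by (simp add: win_from_first_step[of s] integrable_measure_pmf_finite finite_set_pmf_rally)
  next
    show "?v (Wins T) = 0" for T
      by (cases T) (simp_all add: win_from_Wins)
  qed
  then show ?thesis by simp
qed

section \<open>Exchanging the teams\<close>

fun swap_team :: "team \<Rightarrow> team" where
  "swap_team Team_A = Team_B"
| "swap_team Team_B = Team_A"

fun swap_server :: "server \<Rightarrow> server" where
  "swap_server A1 = B1"
| "swap_server A2 = B2"
| "swap_server B1 = A1"
| "swap_server B2 = A2"

fun swap_state :: "state \<Rightarrow> state" where
  "swap_state (Playing i j k) = Playing j i (swap_server k)"
| "swap_state (Wins T) = Wins (swap_team T)"

lemma swap_point_A: "swap_state (point_A n i j k) = point_B n j i (swap_server k)"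
  by (auto simp: point_A_def point_B_def)

lemma swap_point_B: "swap_state (point_B n i j k) = point_A n j i (swap_server k)"
  by (auto simp: point_A_def point_B_def)

text \<open>The point rules are mirror images, and \<open>swap_server\<close> shifts the cyclic
  serving order A1, A2, B1, B2 by two places.\<close>

lemma rally_swap: "rally n pB pA (swap_state s) = map_pmf swap_state (rally n pA pB s)"
  by (cases "(n, pA, pB, s)" rule: rally.cases)
    (simp_all add: map_pmf_comp swap_point_A swap_point_B if_distrib[of swap_state] cong: if_cong)

text \<open>By \<open>rally_swap\<close>, Team B's winning function for \<open>(pB, pA)\<close>,
  composed with \<open>swap_state\<close>, is harmonic for \<open>(pA, pB)\<close> and has Team A's
  boundary values; uniqueness gives equality without comparing path measures.\<close>

lemma win_from_swap:
  assumes "n \<ge> 1" "(pA, pB) \<in> parameters" "s \<in> states n"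
  shows "win_from n Team_B pB pA (swap_state s) = win_from n Team_A pA pB s"
proof -
  let ?v = "\<lambda>s. win_from n Team_B pB pA (swap_state s) - win_from n Team_A pA pB s"
  have "?v s = 0"
  proof (rule rally_harmonic_eq_0[OF assms(1,2) _ _ assms(3)])
    fix s assume "s \<notin> range Wins"
    moreover from this have "swap_state s \<notin> range Wins" by (cases s) auto
    ultimately show "?v s = measure_pmf.expectation (rally n pA pB s) ?v"
      by (simp add: win_from_first_step[of s] win_from_first_step[of "swap_state s"] rally_swap
          integrable_measure_pmf_finite finite_set_pmf_rally)
  next
    show "?v (Wins T) = 0" for T
      by (cases T) (simp_all add: win_from_Wins)
  qed
  then show ?thesis by simp
qed

section \<open>First-step analysis as a polynomial linear system\<close>

text \<open>The rows of the absorbing states are zero, so that their equations in the linear system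
  prescribe the boundary values.\<close>

fun rally_poly :: "nat \<Rightarrow> state \<Rightarrow> state \<Rightarrow> real poly poly" where
  "rally_poly n (Playing i j A1) t =
     [:0, 1:] * of_bool (point_A n i j A1 = t) + (1 - [:0, 1:]) * of_bool (Playing i j A2 = t)"
| "rally_poly n (Playing i j A2) t =
     [:0, 1:] * of_bool (point_A n i j A2 = t) + (1 - [:0, 1:]) * of_bool (Playing i j B1 = t)"
| "rally_poly n (Playing i j B1) t =
     [:[:0, 1:]:] * of_bool (point_B n i j B1 = t) + (1 - [:[:0, 1:]:]) * of_bool (Playing i j B2 = t)"
| "rally_poly n (Playing i j B2) t =
     [:[:0, 1:]:] * of_bool (point_B n i j B2 = t) + (1 - [:[:0, 1:]:]) * of_bool (Playing i j A1 = t)"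
| "rally_poly n (Wins T) t = 0"

text \<open>The sum form is polynomial in \<open>p\<close> and stays right when \<open>f\<close>
  sends both outcomes to \<open>t\<close>. The bounds matter since \<open>bernoulli_pmf\<close>
  clamps its argument to [0,1].\<close>

lemma pmf_map_bernoulli:
  assumes "0 \<le> p" "p \<le> 1"
  shows "pmf (map_pmf f (bernoulli_pmf p)) t = p * of_bool (f True = t) + (1 - p) * of_bool (f False = t)"
proof -
  have "pmf (map_pmf f (bernoulli_pmf p)) t = measure_pmf.expectation (bernoulli_pmf p) (\<lambda>w. of_bool (f w = t))"
    by (simp add: map_pmf_def pmf_bind pmf_return indicator_def of_bool_def)
  also have "\<dots> = p * of_bool (f True = t) + (1 - p) * of_bool (f False = t)"
    by (simp add: assms)
  finally show ?thesis .
qed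

text \<open>\<open>[:0, 1:]\<close> evaluates to \<open>pA\<close> and \<open>[:[:0, 1:]:]\<close>
  to \<open>pB\<close>. Absorbing states are excluded: their rows are zero, whereas the chain stays
  there with probability 1.\<close>

lemma poly2_rally_poly:
  assumes "(pA, pB) \<in> parameters" "s \<notin> range Wins"
  shows "poly2 (rally_poly n s t) pA pB = pmf (rally n pA pB s) t"
proof -
  have p: "0 \<le> pA" "pA \<le> 1" "0 \<le> pB" "pB \<le> 1" using assms(1) by auto
  interpret hom: comm_ring_hom "\<lambda>P. poly2 P pA pB"
    by (rule comm_ring_hom_poly2)
  have [simp]: "poly2 [:0, 1:] pA pB = pA" "poly2 [:[:0, 1:]:] pA pB = pB"
    "poly2 (of_bool b) pA pB = of_bool b" for b
    by (simp_all add: poly2_def)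
  note eval = hom.hom_add hom.hom_mult hom.hom_minus hom.hom_one
  show ?thesis
  proof (cases s)
    case (Playing i j k)
    then show ?thesis
      using p by (cases k) (simp_all only: rally_poly.simps rally.simps pmf_map_bernoulli eval, simp_all)
  qed (use assms(2) in simp)
qed

text \<open>The chain does not leave the finite set \<open>states n\<close>. The identity translates
  between harmonicity and the linear equations.\<close>

lemma expectation_rally:
  assumes "n \<ge> 1" "(pA, pB) \<in> parameters" "s \<in> states n" "s \<notin> range Wins"
  shows "measure_pmf.expectation (rally n pA pB s) v =
    (\<Sum>t\<in>states n. poly2 (rally_poly n s t) pA pB * (v t :: real))"
  unfolding poly2_rally_poly[OF assms(2,4)]
  by (subst integral_measure_pmf_real[where A = "states n"])
    (use finite_states rally_in_states[OF assms(1,3)] in \<open>auto simp: mult.commute\<close>)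

text \<open>The first-step equations form the linear system, with the boundary values as
  inhomogeneous term; its uniqueness is \<open>rally_harmonic_eq_0\<close>.\<close>

lemma rational_win_from:
  assumes "n \<ge> 1" "s \<in> states n"
  shows "rational_function_on parameters (\<lambda>pA pB. win_from n W pA pB s)"
proof (rule rational_function_on_linear_system[where S = "states n" and M = "rally_poly n"
      and c = "\<lambda>s. of_bool (s = Wins W)" and h = "\<lambda>pA pB. win_from n W pA pB"])
  fix x y s assume D: "(x, y) \<in> parameters" and s: "s \<in> states n"
  show "win_from n W x y s = (\<Sum>t\<in>states n. poly2 (rally_poly n s t) x y * win_from n W x y t) +
      poly2 (of_bool (s = Wins W)) x y"
  proof (cases "s \<in> range Wins")
    case True
    then show ?thesis by (auto simp: win_from_Wins poly2_def)
  next
    case False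
    then have "s \<noteq> Wins W" by auto
    then have "poly2 (of_bool (s = Wins W)) x y = 0" by (simp add: poly2_def)
    then show ?thesis
      using win_from_first_step[OF False, of n W x y]
        expectation_rally[OF assms(1) D s False, of "win_from n W x y"]
      by linarith
  qed
next
  fix x y s and v :: "state \<Rightarrow> real"
  assume D: "(x, y) \<in> parameters"
    and v: "\<And>s. s \<in> states n \<Longrightarrow> v s = (\<Sum>t\<in>states n. poly2 (rally_poly n s t) x y * v t)"
    and s: "s \<in> states n"
  show "v s = 0"
  proof (rule rally_harmonic_eq_0[OF assms(1) D _ _ s])
    show "v s = measure_pmf.expectation (rally n x y s) v" if "s \<in> states n" "s \<notin> range Wins" for s
      using v[OF that(1)] expectation_rally[OF assms(1) D that] by simp
    \<comment> \<open>In the homogeneous system the zero row of \<open>Wins T\<close> forces the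
      value 0.\<close>
    show "v (Wins T) = 0" for T
    proof -
      have "Wins T \<in> states n" by (cases T) (auto simp: states_def)
      from v[OF this] show ?thesis by (simp add: poly2_def)
    qed
  qed
qed (use finite_states assms in auto)

section \<open>Consequences for the serve gain\<close>

lemma win_prob_complement:
  assumes "n \<ge> 1" "(pA, pB) \<in> parameters"
  shows "win_prob n pA pB Team_A F = 1 - win_prob n pA pB Team_B F"
  using win_from_complement[OF assms initial_in_states[OF assms(1), of F]] by (simp add: win_prob_eq)

lemma win_prob_swap:
  assumes "n \<ge> 1" "(pA, pB) \<in> parameters"
  shows "win_prob n pA pB Team_A Team_A = win_prob n pB pA Team_B Team_B"
  using win_from_swap[OF assms initial_in_states[OF assms(1), of Team_A]] by (simp add: win_prob_eq)

text \<open>The complement rule is used with Team B serving first; the swap then turns B's win into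
  a win of A with the parameters exchanged. Symmetry and the value on the diagonal can be read off
  the right-hand side.\<close>

lemma serve_gain_eq:
  assumes "n \<ge> 1" "(pA, pB) \<in> parameters"
  shows "serve_gain n pA pB = win_prob n pA pB Team_A Team_A + win_prob n pB pA Team_A Team_A - 1"
proof -
  have "(pB, pA) \<in> parameters" using assms(2) by auto
  then show ?thesis
    using win_prob_complement[OF assms, of Team_B] win_prob_swap[OF assms(1)]
    by (simp add: serve_gain_def)
qed

theorem theorem2:
  fixes n :: nat
  assumes "n \<ge> 1"
  shows "symmetric_on ({0..1} \<times> {0..1} - {(0, 0)}) (serve_gain n) \<and>
    rational_function_on ({0..1} \<times> {0..1} - {(0, 0)}) (serve_gain n) \<and>
    (\<forall>x \<in> {0<..1}. win_prob n x x Team_A Team_A = win_prob n x x Team_B Team_B \<and>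
       serve_gain n x x = 2 * win_prob n x x Team_A Team_A - 1)"
proof (intro conjI ballI)
  have "serve_gain n x y = serve_gain n y x" if "(x, y) \<in> parameters" for x y
  proof -
    have "(y, x) \<in> parameters" using that by auto
    then show ?thesis using serve_gain_eq[OF assms that] serve_gain_eq[OF assms, of y x] by simp
  qed
  then show "symmetric_on parameters (serve_gain n)"
    unfolding symmetric_on_def by blast
  show "rational_function_on parameters (serve_gain n)"
    unfolding serve_gain_def[abs_def] win_prob_eq
    by (rule rational_function_on_diff; rule rational_win_from[OF assms initial_in_states[OF assms]])
next
  fix x :: real assume "x \<in> {0<..1}"
  then have x: "(x, x) \<in> parameters" by auto
  show "win_prob n x x Team_A Team_A = win_prob n x x Team_B Team_B"
    by (rule win_prob_swap[OF assms x])
  show "serve_gain n x x = 2 * win_prob n x x Team_A Team_A - 1"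
    using serve_gain_eq[OF assms x] by simp
qed

end
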